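(* Let $D$ be a commutative ring, let $I$ be an integrally closed ideal of $D$, and set $R := D/I$. Let $n \in \mathbb{N}$ and let $A$ be a $1$-principled $n\times n$-matrix over $R$. Then $A^m$ is $1$-principled for every $m \in \mathbb{Z}$.
   Context: All rings are commutative, associative and unital; $\mathbb{N}=\{0,1,2,\ldots\}$ and $[n]:=\{1,2,\ldots,n\}$. For an $n\times n$-matrix $A=(a_{i,j})_{i,j\in[n]}$ over a ring and $S\subseteq[n]$, $A_S$ denotes the principal submatrix of $A$ with row and column set $S$; the empty determinant is $1$. The matrix $A$ is called $1$-principled if $\det A_S = 1$ for every $S\subseteq[n]$. (Such a matrix has determinant $1$, hence is invertible, so $A^m$ is defined for every integer $m$.) Let $D$ be a commutative ring and $I$ an ideal of $D$. An element $x\in D$ is integral over $I$ if there exist a positive integer $d$ and elements $c_j\in I^j$ for all $j\in[d]$ such that $x^d+c_1x^{d-1}+c_2x^{d-2}+\cdots+c_d=0$. The integral closure $\overline{I}$ is the set of all elements of $D$ integral over $I$. The ideal $I$ is integrally closed if $\overline{I}=I$. *)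

theory Defs
  imports "HOL-Algebra.QuotRing" "HOL-Algebra.Ideal_Product" "HOL-Combinatorics.Permutations"
begin

section \<open>Integral closure of an ideal\<close>

text \<open>The power of an ideal is taken in the multiplicative monoid of ideals of \<open>D\<close>,
  so \<open>I\<close> to the power \<open>j\<close> is the ideal product of \<open>j\<close> copies of \<open>I\<close>.\<close>

definition integral_over_ideal ::
  "('a, 'b) ring_scheme \<Rightarrow> 'a set \<Rightarrow> 'a \<Rightarrow> bool"
  where "integral_over_ideal D I x \<longleftrightarrow>
    (\<exists>d::nat. d > 0 \<and>
      (\<exists>c::nat \<Rightarrow> 'a.
        (\<forall>j\<in>{1..d}. c j \<in> I [^]\<^bsub>ideals_set D\<^esub> j) \<and>
        x [^]\<^bsub>D\<^esub> d \<oplus>\<^bsub>D\<^esub> (\<Oplus>\<^bsub>D\<^esub>j\<in>{1..d}. c j \<otimes>\<^bsub>D\<^esub> x [^]\<^bsub>D\<^esub> (d - j)) = \<zero>\<^bsub>D\<^esub>))"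

definition integral_closure :: "('a, 'b) ring_scheme \<Rightarrow> 'a set \<Rightarrow> 'a set"
  where "integral_closure D I = {x \<in> carrier D. integral_over_ideal D I x}"

definition integrally_closed :: "('a, 'b) ring_scheme \<Rightarrow> 'a set \<Rightarrow> bool"
  where "integrally_closed D I \<longleftrightarrow> integral_closure D I = I"

section \<open>Square matrices over a ring\<close>

text \<open>A square matrix with rows and columns indexed by a finite set \<open>S\<close> is a function
  \<open>A\<close> with entries \<open>A i j\<close>; extensionality (the value \<open>undefined\<close> outside the index set)
  makes equality of such functions coincide with equality of matrices.  In particular,
  inverses in the monoid below are unique, and integer powers can be taken with the
  library's \<open>[^]\<close>.\<close>

definition mat_monoid ::
  "('a, 'b) ring_scheme \<Rightarrow> 'i set \<Rightarrow> ('i \<Rightarrow> 'i \<Rightarrow> 'a) monoid"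
  where "mat_monoid R S =
    \<lparr>carrier = S \<rightarrow>\<^sub>E (S \<rightarrow>\<^sub>E carrier R),
     monoid.mult = (\<lambda>A B. \<lambda>i\<in>S. \<lambda>j\<in>S. \<Oplus>\<^bsub>R\<^esub>k\<in>S. A i k \<otimes>\<^bsub>R\<^esub> B k j),
     one = (\<lambda>i\<in>S. \<lambda>j\<in>S. if i = j then \<one>\<^bsub>R\<^esub> else \<zero>\<^bsub>R\<^esub>)\<rparr>"

text \<open>The Leibniz formula; for \<open>S = {}\<close> it gives \<open>\<one>\<close>.\<close>

definition mat_det :: "('a, 'b) ring_scheme \<Rightarrow> 'i set \<Rightarrow> ('i \<Rightarrow> 'i \<Rightarrow> 'a) \<Rightarrow> 'a"
  where "mat_det R S A =
    (\<Oplus>\<^bsub>R\<^esub>p\<in>{p. p permutes S}. add_pow R (sign p) (\<Otimes>\<^bsub>R\<^esub>i\<in>S. A i (p i)))"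

definition principal_submatrix :: "('i \<Rightarrow> 'i \<Rightarrow> 'a) \<Rightarrow> 'i set \<Rightarrow> ('i \<Rightarrow> 'i \<Rightarrow> 'a)"
  where "principal_submatrix A S = (\<lambda>i\<in>S. \<lambda>j\<in>S. A i j)"

definition one_principled ::
  "('a, 'b) ring_scheme \<Rightarrow> nat \<Rightarrow> (nat \<Rightarrow> nat \<Rightarrow> 'a) \<Rightarrow> bool"
  where "one_principled R n A \<longleftrightarrow>
    A \<in> carrier (mat_monoid R {1..n}) \<and>
    (\<forall>S. S \<subseteq> {1..n} \<longrightarrow> mat_det R S (principal_submatrix A S) = \<one>\<^bsub>R\<^esub>)"

end

theory Submission
  imports Defs "HOL-Combinatorics.Cycles" "Jordan_Normal_Form.Missing_Ring"
begin

text \<open>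
  View the matrix as a complete digraph on its index set, the edge from \<open>x\<close> to \<open>y\<close> carrying
  the entry in row \<open>x\<close> and column \<open>y\<close>; a walk weighs the product of its edges.  Over the
  quotient \<open>R\<close> by an integrally closed ideal \<open>I\<close>, a matrix is 1-principled if and only if its
  diagonal entries are 1 and every loopless closed walk has weight 0.  The second condition
  passes from a matrix to its powers, so the proof consists of the two directions of this
  equivalence and of that inheritance.

  \<^bold>\<open>Principal minors 1 force closed walks to vanish\<close> (\<open>closed_walk_weight_zero\<close>).  Lift the
  entries to \<open>D\<close>; the claim becomes that closed walks weigh elements of \<open>I\<close>, and it is proved
  by induction on their length.  A walk that repeats a vertex splits into two shorter closed
  walks, so consider a cycle through each of the \<open>k\<close> vertices of a set \<open>S\<close> once.  In the Leibniz
  formula for the minor of \<open>S\<close>, the identity contributes 1 and each permutation with a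
  nontrivial orbit other than \<open>S\<close> contributes 0 in \<open>R\<close>, by induction.  Hence the signed
  weights \<open>x\<^sub>p\<close> of the permutations \<open>p\<close> that are cycles on all of \<open>S\<close> sum up to an element
  of \<open>I\<close>.  Moreover \<open>x\<^sub>p x\<^sub>q\<close> lies in the square of \<open>I\<close> for \<open>p \<noteq> q\<close>: an edge of \<open>q\<close> that is not in \<open>p\<close> is a chord of
  the cycle \<open>p\<close>, and exchanging tails turns the two cycles into a closed walk shorter than
  \<open>k\<close> and one of length strictly between \<open>k\<close> and \<open>2 k\<close>; the latter repeats a vertex, and one of its
  two parts is again shorter than \<open>k\<close>.  With \<open>t\<close> the sum of all \<open>x\<^sub>q\<close> and \<open>r\<close> the sum of \<open>x\<^sub>p x\<^sub>q\<close> over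
  \<open>q \<noteq> p\<close>, the element \<open>x\<^sub>p\<close> is a root of \<open>X\<^sup>2 - t X + r\<close>, hence integral over \<open>I\<close>, hence in \<open>I\<close>.

  \<^bold>\<open>Powers stay inside a group of matrices with vanishing closed walks.\<close>  Let \<open>J x y\<close> be
  the ideal generated by the weights of the walks from \<open>x\<close> to \<open>y\<close>.  Concatenation of walks
  gives \<open>J x y J y z \<subseteq> J x z\<close>, and the vanishing of closed walks gives \<open>J x y J y x = 0\<close> for
  \<open>x \<noteq> y\<close> (\<open>path_ideals_acyclic\<close>).  These two rules suffice to see that the matrices \<open>B\<close> with
  diagonal 1 and \<open>B x y \<in> J x y\<close> are closed under multiplication and, by column operations
  within the family, under inversion (\<open>unipotents_int_pow\<close>), and that all their principal
  minors are 1, because every other term of the Leibniz formula contains a closed walk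
  (\<open>unipotents_minor\<close>).
\<close>

section \<open>Weights of closed walks\<close>

text \<open>A closed walk is the list of its vertices without the final return to the first one, so
  that its length is the number of edges.  The condition includes the closing edge; in
  particular a single vertex is excluded.\<close>

definition loopless_closed :: "'v list \<Rightarrow> bool"
  where "loopless_closed ws \<longleftrightarrow> ws \<noteq> [] \<and> distinct_adj (ws @ [hd ws])"

fun path_weight :: "('r, 'm) ring_scheme \<Rightarrow> ('v \<Rightarrow> 'v \<Rightarrow> 'r) \<Rightarrow> 'v list \<Rightarrow> 'r"
  where
    "path_weight R a (x # y # ws) = a x y \<otimes>\<^bsub>R\<^esub> path_weight R a (y # ws)"
  | "path_weight R a ws = \<one>\<^bsub>R\<^esub>"

definition closed_weight :: "('r, 'm) ring_scheme \<Rightarrow> ('v \<Rightarrow> 'v \<Rightarrow> 'r) \<Rightarrow> 'v list \<Rightarrow> 'r"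
  where "closed_weight R a ws = path_weight R a (ws @ [hd ws])"

lemma distinct_imp_distinct_adj: "distinct ws \<Longrightarrow> distinct_adj ws"
  by (induction ws rule: induct_list012) auto

lemma loopless_closed_distinct:
  assumes "distinct ws" and "length ws > 1"
  shows "loopless_closed ws"
proof -
  obtain x us where ws: "ws = x # us" "us \<noteq> []"
    using assms(2) by (cases ws) auto
  then have "last ws \<noteq> hd ws"
    using assms(1) by auto
  then show ?thesis
    using assms(1) ws by (auto simp: loopless_closed_def distinct_adj_append_iff distinct_imp_distinct_adj
      simp del: append_Cons)
qed

locale weighted_digraph = cring R for R (structure) +
  fixes V :: "'v set" and a :: "'v \<Rightarrow> 'v \<Rightarrow> 'a"
  assumes weight_closed: "\<And>x y. x \<in> V \<Longrightarrow> y \<in> V \<Longrightarrow> a x y \<in> carrier R"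
begin

lemma path_weight_closed [simp]: "set ws \<subseteq> V \<Longrightarrow> path_weight R a ws \<in> carrier R"
  by (induction ws rule: induct_list012) (auto simp: weight_closed)

lemma closed_weight_closed [simp]:
  "ws \<noteq> [] \<Longrightarrow> set ws \<subseteq> V \<Longrightarrow> closed_weight R a ws \<in> carrier R"
  by (simp add: closed_weight_def subset_iff)

lemma path_weight_join:
  "set (us @ x # ws) \<subseteq> V \<Longrightarrow>
    path_weight R a (us @ x # ws) = path_weight R a (us @ [x]) \<otimes> path_weight R a (x # ws)"
proof (induction us)
  case (Cons u us)
  then show ?case
    by (cases us) (auto simp: weight_closed m_assoc)
qed simp

lemma closed_weight_split:
  assumes "set (xs @ y # ys @ y # zs) \<subseteq> V"
  shows "closed_weight R a (xs @ y # ys @ y # zs)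
    = closed_weight R a (y # ys) \<otimes> closed_weight R a (xs @ y # zs)"
proof -
  define h where "h = hd (xs @ y # zs)"
  have h: "hd (xs @ y # ys @ y # zs) = h" "h \<in> V"
    using assms by (cases xs; simp add: h_def)+
  have "path_weight R a (xs @ y # ys @ y # zs @ [h])
      = path_weight R a (xs @ [y]) \<otimes> (path_weight R a ((y # ys) @ [y]) \<otimes> path_weight R a (y # zs @ [h]))"
    using assms h path_weight_join[of xs y "ys @ y # zs @ [h]"]
      path_weight_join[of "y # ys" y "zs @ [h]"] by simp
  moreover have "path_weight R a (xs @ y # zs @ [h])
      = path_weight R a (xs @ [y]) \<otimes> path_weight R a (y # zs @ [h])"
    using assms h path_weight_join[of xs y "zs @ [h]"] by simp
  ultimately show ?thesis
    using assms h by (simp add: closed_weight_def h_def [symmetric] m_lcomm)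
qed

text \<open>Two closed walks with a common starting vertex, both passing through \<open>i\<close>, the second one
  returning to the start from there: the closing edge of the second walk is used to close
  the first one early, and the remaining edges make up a closed walk through \<open>i\<close>.\<close>

lemma closed_weight_exchange:
  assumes "set (xs @ i # ys) \<subseteq> V" and "set (zs @ [i]) \<subseteq> V"
    and "xs \<noteq> []" and "zs \<noteq> []" and "hd xs = hd zs"
  shows "closed_weight R a (xs @ i # ys) \<otimes> closed_weight R a (zs @ [i])
    = closed_weight R a (xs @ [i]) \<otimes> closed_weight R a (i # ys @ zs)"
proof -
  obtain j xs' zs' where xs: "xs = j # xs'" and zs: "zs = j # zs'"
    using assms by (cases xs; cases zs; simp)
  have V: "i \<in> V" "j \<in> V" "set xs' \<subseteq> V" "set zs' \<subseteq> V" "set ys \<subseteq> V"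
    using assms by (auto simp: xs zs)
  have "path_weight R a (xs @ i # ys @ [j])
      = path_weight R a (xs @ [i]) \<otimes> path_weight R a (i # ys @ [j])"
    using V path_weight_join[of xs i "ys @ [j]"] by (simp add: xs)
  moreover have "path_weight R a (xs @ [i, j]) = path_weight R a (xs @ [i]) \<otimes> a i j"
    "path_weight R a (zs @ [i, j]) = path_weight R a (zs @ [i]) \<otimes> a i j"
    using V path_weight_join[of xs i "[j]"] path_weight_join[of zs i "[j]"]
    by (simp_all add: weight_closed xs zs)
  moreover have "path_weight R a (i # ys @ zs @ [i])
      = path_weight R a (i # ys @ [j]) \<otimes> path_weight R a (zs @ [i])"
    using V path_weight_join[of "i # ys" j "zs' @ [i]"] by (simp add: zs)
  moreover have "closed_weight R a (xs @ i # ys) = path_weight R a (xs @ i # ys @ [j])"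
    "closed_weight R a (zs @ [i]) = path_weight R a (zs @ [i, j])"
    "closed_weight R a (xs @ [i]) = path_weight R a (xs @ [i, j])"
    "closed_weight R a (i # ys @ zs) = path_weight R a (i # ys @ zs @ [i])"
    by (simp_all add: closed_weight_def xs zs)
  moreover have "path_weight R a (xs @ [i]) \<in> carrier R" "path_weight R a (zs @ [i]) \<in> carrier R"
    "path_weight R a (i # ys @ [j]) \<in> carrier R" "a i j \<in> carrier R"
    using V by (simp_all add: xs zs weight_closed)
  ultimately show ?thesis
    by (simp only: m_ac m_closed)
qed

text \<open>Cutting at the two occurrences of a repeated vertex preserves looplessness, since no
  new pair of consecutive vertices arises.\<close>

lemma loopless_closed_decompose:
  assumes "loopless_closed ws" and "\<not> distinct ws" and "set ws \<subseteq> V"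
  obtains us vs where "loopless_closed us" "loopless_closed vs"
    "set us \<subseteq> set ws" "set vs \<subseteq> set ws" "length us + length vs = length ws"
    "closed_weight R a ws = closed_weight R a us \<otimes> closed_weight R a vs"
proof -
  obtain xs y ys zs where ws: "ws = xs @ y # ys @ y # zs"
    using not_distinct_decomp[OF assms(2)] by auto
  have hd: "hd ws = hd (xs @ y # zs)"
    by (cases xs) (auto simp: ws)
  have join: "distinct_adj (us @ x # vs) \<longleftrightarrow> distinct_adj (us @ [x]) \<and> distinct_adj (x # vs)"
    for us vs and x :: 'v
    by (induction us rule: induct_list012) (auto simp: distinct_adj_Cons)
  have adj: "distinct_adj (xs @ [y])" "distinct_adj (y # ys @ [y])" "distinct_adj (y # zs @ [hd ws])"
    using assms(1) join[of xs y "ys @ y # zs @ [hd ws]"] join[of "y # ys" y "zs @ [hd ws]"]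
    by (simp_all add: loopless_closed_def ws)
  have "loopless_closed (y # ys)"
    using adj(2) by (simp add: loopless_closed_def)
  moreover have "loopless_closed (xs @ y # zs)"
    using adj(1,3) join[of xs y "zs @ [hd ws]"] by (simp add: loopless_closed_def hd [symmetric])
  moreover have "closed_weight R a ws = closed_weight R a (y # ys) \<otimes> closed_weight R a (xs @ y # zs)"
    using closed_weight_split[of xs y ys zs] assms(3) by (simp add: ws)
  ultimately show thesis
    by (intro that[of "y # ys" "xs @ y # zs"]) (auto simp: ws)
qed

text \<open>The hypothesis on \<open>p\<close> says that it moves each vertex of the cycle to the next one, so both
  sides multiply the same edges.\<close>

lemma closed_weight_cycle:
  assumes "distinct ws" and "ws \<noteq> []" and "set ws \<subseteq> V" and "map p ws = rotate1 ws"
  shows "closed_weight R a ws = (\<Otimes>x\<in>set ws. a x (p x))"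
proof -
  have "path_weight R a (ws @ [z]) = (\<Otimes>x\<in>set ws. a x (p x))"
    if "distinct ws" "set ws \<subseteq> V" "z \<in> V" "ws \<noteq> []" "map p ws = tl ws @ [z]" for ws z
    using that
  proof (induction ws)
    case (Cons x ws)
    show ?case
    proof (cases ws)
      case Nil
      with Cons show ?thesis by (simp add: weight_closed)
    next
      case (Cons y ys)
      have "path_weight R a (ws @ [z]) = (\<Otimes>x\<in>set ws. a x (p x))"
        using Cons.IH Cons.prems Cons by auto
      moreover have "p u \<in> V" if "u \<in> set ws" for u
      proof -
        have "p u \<in> set (map p (x # ws))" using that by auto
        then show ?thesis using Cons.prems by (auto simp del: list.map)
      qed
      ultimately show ?thesis
        using Cons.prems Cons by (auto simp: weight_closed subset_iff Pi_iff)
    qed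
  qed simp
  from this[of ws "hd ws"] assms show ?thesis
    by (cases ws) (auto simp: closed_weight_def)
qed

end

section \<open>Permutations and their cycles\<close>

lemma map_support:
  assumes "permutation p"
  shows "map p (support p x) = rotate1 (support p x)" and "hd (support p x) = x"
proof -
  let ?d = "least_power p x"
  have d: "?d > 0" "(p ^^ ?d) x = x"
    using least_power_of_permutation[OF assms] by auto
  then obtain e where e: "?d = Suc e" by (cases ?d) auto
  show hd: "hd (support p x) = x"
    using d(1) by (simp add: hd_map)
  have "map p (support p x) = map (\<lambda>i. (p ^^ i) x) (map Suc [0..<Suc e])"
    by (simp add: e)
  also have "\<dots> = map (\<lambda>i. (p ^^ i) x) ([1..<Suc e] @ [Suc e])"
    by (simp add: map_Suc_upt del: upt_Suc) simp
  also have "\<dots> = rotate1 (support p x)"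
    using d(2) by (simp add: e upt_conv_Cons del: upt_Suc)
  finally show "map p (support p x) = rotate1 (support p x)" .
qed

lemma set_support_subset:
  assumes "p permutes S" "x \<in> S"
  shows "set (support p x) \<subseteq> S"
proof
  fix y assume "y \<in> set (support p x)"
  then obtain i where "y = (p ^^ i) x" by auto
  then show "y \<in> S"
    using permutes_in_image[OF permutes_funpow[OF assms(1)], of i x] assms(2) by simp
qed

lemma loopless_closed_support:
  assumes "permutation p" and "p x \<noteq> x"
  shows "loopless_closed (support p x)"
  using assms by (intro loopless_closed_distinct cycle_of_permutation) (auto simp: least_power_gt_one)

context weighted_digraph
begin

lemma permutation_weight_closed [simp]:
  assumes "p permutes S" and "S \<subseteq> V"
  shows "(\<Otimes>x\<in>S. a x (p x)) \<in> carrier R"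
  using assms permutes_in_image[OF assms(1)] by (intro finprod_closed) (auto intro!: weight_closed)

text \<open>The product over \<open>S\<close> splits along the orbits of \<open>p\<close>, and the part of the orbit of \<open>x\<close> is
  the weight of a closed walk.\<close>

lemma permutation_weight_factor:
  assumes "p permutes S" and "finite S" and "S \<subseteq> V" and "x \<in> S"
  shows "\<exists>c\<in>carrier R. (\<Otimes>y\<in>S. a y (p y)) = closed_weight R a (support p x) \<otimes> c"
proof -
  let ?T = "set (support p x)"
  have p: "permutation p"
    using assms permutation_permutes by blast
  have T: "?T \<subseteq> S"
    using set_support_subset assms by metis
  have closed: "(\<lambda>y. a y (p y)) \<in> S \<rightarrow> carrier R"
    using assms permutes_in_image[OF assms(1)] by (auto intro!: weight_closed)
  have ne: "support p x \<noteq> []"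
    using least_power_of_permutation(2)[OF p, of x] by simp
  have "(\<Otimes>y\<in>S. a y (p y)) = (\<Otimes>y\<in>?T \<union> (S - ?T). a y (p y))"
    using T by (simp only: Un_Diff_cancel Un_absorb1)
  also have "\<dots> = (\<Otimes>y\<in>?T. a y (p y)) \<otimes> (\<Otimes>y\<in>S - ?T. a y (p y))"
    using T closed assms(2) by (intro finprod_Un_disjoint) (auto simp del: set_map)
  also have "(\<Otimes>y\<in>?T. a y (p y)) = closed_weight R a (support p x)"
    using T assms(3) ne
    by (intro closed_weight_cycle [symmetric] cycle_of_permutation map_support p) auto
  finally have "(\<Otimes>y\<in>S. a y (p y)) = closed_weight R a (support p x) \<otimes> (\<Otimes>y\<in>S - ?T. a y (p y))" .
  moreover have "(\<Otimes>y\<in>S - ?T. a y (p y)) \<in> carrier R"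
    using closed by (intro finprod_closed) auto
  ultimately show ?thesis
    by blast
qed

end

text \<open>For \<open>S\<close> with at least two elements these are the cycles of full length on \<open>S\<close>.  They are
  the permutations that do not factor through a shorter cycle: each other permutation except
  the identity has a nontrivial orbit that is smaller than \<open>S\<close>.\<close>

definition single_cycles :: "'v set \<Rightarrow> ('v \<Rightarrow> 'v) set"
  where "single_cycles S =
    {p. p permutes S \<and> p \<noteq> id \<and> (\<forall>x. p x \<noteq> x \<longrightarrow> set (support p x) = S)}"

lemma single_cycles_support:
  assumes "p \<in> single_cycles S" and "finite S" and "x \<in> S"
  shows "p x \<noteq> x" and "set (support p x) = S"
proof -
  have p: "p permutes S" "p \<noteq> id"
    using assms(1) by (auto simp: single_cycles_def)
  then obtain y where y: "p y \<noteq> y"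
    by (auto simp: fun_eq_iff)
  then have "set (support p y) = S"
    using assms(1) by (auto simp: single_cycles_def)
  then obtain i where x: "x = (p ^^ i) y"
    using assms(3) by auto
  have "inj (p ^^ i)"
    using p(1) by (simp add: inj_fn permutes_inj)
  moreover have "p x = (p ^^ i) (p y)"
    by (simp add: x flip: funpow_swap1)
  ultimately show "p x \<noteq> x"
    using y by (auto simp: x inj_eq)
  then show "set (support p x) = S"
    using assms(1) by (auto simp: single_cycles_def)
qed

lemma cycle_of_list_single_cycle:
  assumes "distinct ws" and "length ws > 1"
  shows "cycle_of_list ws \<in> single_cycles (set ws)"
proof -
  let ?c = "cycle_of_list ws"
  have shift: "(?c ^^ n) (ws ! i) = ws ! ((n + i) mod length ws)" if "i < length ws" for n i
  proof -
    have "map (?c ^^ n) ws ! i = rotate n ws ! i"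
      using cyclic_rotation[OF assms(1)] by simp
    then show ?thesis
      using that by (simp add: nth_rotate)
  qed
  have "?c (ws ! 0) \<noteq> ws ! 0"
    using shift[of 0 1] assms by (cases "ws = []") (simp_all add: nth_eq_iff_index_eq)
  then have "?c \<noteq> id"
    by auto
  moreover have "set (support ?c x) = set ws" if "?c x \<noteq> x" for x
  proof
    have x: "x \<in> set ws"
      using that id_outside_supp by metis
    then show "set (support ?c x) \<subseteq> set ws"
      by (rule set_support_subset[OF cycle_permutes])
    obtain i where i: "i < length ws" "x = ws ! i"
      using x by (auto simp: in_set_conv_nth)
    show "set ws \<subseteq> set (support ?c x)"
    proof
      fix y assume "y \<in> set ws"
      then obtain k where k: "k < length ws" "y = ws ! k"
        by (auto simp: in_set_conv_nth)
      then have "y = (?c ^^ (k + length ws - i)) x"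
        using shift[OF i(1), of "k + length ws - i"] i by simp
      then show "y \<in> set (support ?c x)"
        unfolding support_set[OF permutation_of_cycle] by blast
    qed
  qed
  ultimately show ?thesis
    by (simp add: single_cycles_def cycle_permutes del: set_map)
qed

lemma support_apply_last:
  assumes "p permutes S" and "finite S" and "support p x = us @ [i]"
  shows "p i = x"
proof -
  have "permutation p" using assms permutation_permutes by blast
  from map_support[OF this, of x] show ?thesis
    unfolding assms(3) by (cases us) auto
qed

lemma support_apply_inner:
  assumes "p permutes S" and "finite S" and "support p x = us @ i # y # vs"
  shows "p i = y"
proof -
  have "permutation p" using assms permutation_permutes by blast
  from map_support(1)[OF this, of x]
  have "map p (us @ i # y # vs) ! length us = rotate1 (us @ i # y # vs) ! length us"
    unfolding assms(3) by simp
  then show ?thesis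
    by (simp add: nth_rotate1 nth_append)
qed

section \<open>Products of two full cycles\<close>

context weighted_digraph
begin

text \<open>A walk longer than the number of vertices repeats one of them, and of the two parts at
  most one can be as long as \<open>card S\<close>, since their total length is below twice that number.\<close>

lemma long_walk_in_ideal:
  assumes "ideal I R" and "finite S" and "S \<subseteq> V"
    and short: "\<And>ws. loopless_closed ws \<Longrightarrow> set ws \<subseteq> S \<Longrightarrow> length ws < card S \<Longrightarrow> closed_weight R a ws \<in> I"
    and "loopless_closed ws" and "set ws \<subseteq> S" and "card S < length ws" and "length ws < 2 * card S"
  shows "closed_weight R a ws \<in> I"
proof -
  interpret ideal I R by fact
  have "\<not> distinct ws"
    using assms(2,6,7) by (metis card_mono distinct_card not_le)
  then obtain us vs where uv: "loopless_closed us" "loopless_closed vs"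
    "set us \<subseteq> set ws" "set vs \<subseteq> set ws" "length us + length vs = length ws"
    "closed_weight R a ws = closed_weight R a us \<otimes> closed_weight R a vs"
    using loopless_closed_decompose assms(3,5,6) by (metis order_trans)
  then have "closed_weight R a us \<in> carrier R" "closed_weight R a vs \<in> carrier R"
    using assms(3,6) by (auto intro!: closed_weight_closed simp: loopless_closed_def)
  moreover have "length us < card S \<or> length vs < card S"
    using uv(5) assms(8) by linarith
  ultimately show ?thesis
    using short[of us] short[of vs] uv assms(6) by (auto intro: I_l_closed I_r_closed)
qed

text \<open>If \<open>p\<close> and \<open>q\<close> disagree at \<open>i\<close>, then the edge \<open>i \<rightarrow> q i\<close> is a chord of the cycle \<open>p\<close>.
  Reading both cycles from \<open>q i\<close> makes this chord the closing edge of \<open>q\<close>, so that the tails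
  can be exchanged at \<open>i\<close>.\<close>

lemma distinct_single_cycles_weight_product:
  assumes "ideal I R" and "finite S" and "S \<subseteq> V"
    and short: "\<And>ws. loopless_closed ws \<Longrightarrow> set ws \<subseteq> S \<Longrightarrow> length ws < card S \<Longrightarrow> closed_weight R a ws \<in> I"
    and p: "p \<in> single_cycles S" and q: "q \<in> single_cycles S" and "p \<noteq> q"
  shows "(\<Otimes>x\<in>S. a x (p x)) \<otimes> (\<Otimes>x\<in>S. a x (q x)) \<in> ideal_prod R I I"
proof -
  have perm: "p permutes S" "q permutes S" "permutation p" "permutation q"
    using p q assms(2) permutation_permutes by (auto simp: single_cycles_def)
  obtain i where i: "p i \<noteq> q i"
    using assms(7) by (auto simp: fun_eq_iff)
  then have iS: "i \<in> S"
    using perm by (metis permutes_not_in)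
  define j where "j = q i"
  have jS: "j \<in> S"
    using perm(2) iS by (simp add: j_def permutes_in_image)
  have ij: "i \<noteq> j"
    using single_cycles_support(1)[OF q assms(2) iS] by (simp add: j_def)
  define P where "P = support p j"
  define Q where "Q = support q j"
  have P: "distinct P" "set P = S" "hd P = j" "map p P = rotate1 P"
    using single_cycles_support(2)[OF p assms(2) jS] cycle_of_permutation[OF perm(3)]
      map_support[OF perm(3)] unfolding P_def by auto
  have Q: "distinct Q" "set Q = S" "hd Q = j" "map q Q = rotate1 Q"
    using single_cycles_support(2)[OF q assms(2) jS] cycle_of_permutation[OF perm(4)]
      map_support[OF perm(4)] unfolding Q_def by auto
  have "P \<noteq> []" "Q \<noteq> []"
    using iS P(2) Q(2) by auto
  obtain xs ys where P_split: "P = xs @ i # ys"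
    using iS P(2) split_list by metis
  obtain zs zs' where Q_split: "Q = zs @ i # zs'"
    using iS Q(2) split_list by metis
  have "xs \<noteq> []"
    using P(3) ij by (auto simp: P_split)
  have "zs \<noteq> []"
    using Q(3) ij by (auto simp: Q_split)
  have hd: "hd xs = j" "hd zs = j"
    using P(3) Q(3) \<open>xs \<noteq> []\<close> \<open>zs \<noteq> []\<close> by (auto simp: P_split Q_split)
  \<comment> \<open>Otherwise \<open>p\<close> would also map \<open>i\<close> to \<open>j\<close>.\<close>
  have "ys \<noteq> []"
    using support_apply_last[OF perm(1) assms(2)] P_split i by (auto simp: P_def j_def)
  \<comment> \<open>As \<open>q\<close> maps \<open>i\<close> to \<open>j\<close>, the cycle \<open>q\<close> read from \<open>j\<close> ends in \<open>i\<close>.\<close>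
  have "zs' = []"
  proof (rule ccontr)
    assume "zs' \<noteq> []"
    then obtain y vs where "zs' = y # vs" by (cases zs') auto
    then have "q i = y"
      using support_apply_inner[OF perm(2) assms(2)] Q_split by (auto simp: Q_def)
    then have "j \<in> set zs'"
      using \<open>zs' = y # vs\<close> by (simp add: j_def)
    moreover have "j \<in> set zs"
      using hd(2) \<open>zs \<noteq> []\<close> hd_in_set by metis
    ultimately show False
      using Q(1) by (auto simp: Q_split)
  qed
  have len: "length P = card S" "length Q = card S"
    using P Q by (metis distinct_card)+
  have wp: "(\<Otimes>x\<in>S. a x (p x)) = closed_weight R a P"
    using closed_weight_cycle[of P p] P assms(3) \<open>P \<noteq> []\<close> by simp
  have wq: "(\<Otimes>x\<in>S. a x (q x)) = closed_weight R a Q"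
    using closed_weight_cycle[of Q q] Q assms(3) \<open>Q \<noteq> []\<close> by simp
  have eq: "closed_weight R a P \<otimes> closed_weight R a Q
      = closed_weight R a (xs @ [i]) \<otimes> closed_weight R a (i # ys @ zs)"
    using closed_weight_exchange[of xs i ys zs] P(2) Q(2) assms(3) hd \<open>xs \<noteq> []\<close> \<open>zs \<noteq> []\<close>
    by (auto simp: P_split Q_split \<open>zs' = []\<close>)
  have "closed_weight R a (xs @ [i]) \<in> I"
  proof (rule short)
    show "loopless_closed (xs @ [i])"
      using P(1) \<open>xs \<noteq> []\<close> by (intro loopless_closed_distinct) (auto simp: P_split)
    show "length (xs @ [i]) < card S"
      using len \<open>ys \<noteq> []\<close> by (cases ys) (auto simp: P_split)
  qed (use P in \<open>auto simp: P_split\<close>)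
  moreover have "closed_weight R a (i # ys @ zs) \<in> I"
  proof (rule long_walk_in_ideal[OF assms(1-3) short])
    have "last ys \<in> set ys" "j \<in> set xs"
      using hd(1) \<open>xs \<noteq> []\<close> \<open>ys \<noteq> []\<close> last_in_set hd_in_set by metis+
    then have "last ys \<noteq> j"
      using P(1) by (auto simp: P_split)
    moreover have "distinct_adj (i # ys)" "distinct_adj (zs @ [i])"
      using P(1) Q(1) by (auto simp: P_split Q_split \<open>zs' = []\<close> intro!: distinct_imp_distinct_adj)
    ultimately have "distinct_adj ((i # ys) @ (zs @ [i]))"
      using hd \<open>ys \<noteq> []\<close> \<open>zs \<noteq> []\<close> by (subst distinct_adj_append_iff) auto
    then show "loopless_closed (i # ys @ zs)"
      by (simp add: loopless_closed_def)
    show "set (i # ys @ zs) \<subseteq> S"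
      using P(2) Q(2) by (auto simp: P_split Q_split)
    show "card S < length (i # ys @ zs)"
      using len \<open>ys \<noteq> []\<close> by (cases ys) (auto simp: Q_split \<open>zs' = []\<close>)
    show "length (i # ys @ zs) < 2 * card S"
      using len \<open>xs \<noteq> []\<close> by (cases xs) (auto simp: P_split Q_split \<open>zs' = []\<close>)
  qed
  ultimately show ?thesis
    unfolding wp wq eq by (rule ideal_prod.prod)
qed

end

section \<open>Principal minors\<close>

lemma mat_det_principal_submatrix:
  assumes "weighted_digraph R V A" and "S \<subseteq> V"
  shows "mat_det R S (principal_submatrix A S) = mat_det R S A"
proof -
  interpret weighted_digraph R V A by fact
  show ?thesis
    unfolding mat_det_def
  proof (intro finsum_cong' refl arg_cong[where f = "add_pow R _"] finprod_cong')
    fix p x assume "p \<in> {p. p permutes S}" "x \<in> S"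
    then show "principal_submatrix A S x (p x) = A x (p x)"
      by (simp add: principal_submatrix_def permutes_in_image)
  qed (use assms in \<open>auto intro!: weight_closed add.int_pow_closed simp: permutes_in_image subset_iff\<close>)
qed

lemma mat_det_singleton:
  assumes "weighted_digraph R V A" and "x \<in> V"
  shows "mat_det R {x} A = A x x"
proof -
  interpret weighted_digraph R V A by fact
  have "A x x \<in> carrier R"
    using assms by (simp add: weight_closed)
  then show ?thesis
    by (simp add: mat_det_def permutes_sing add.int_pow_1)
qed

text \<open>The hypothesis \<open>other\<close> is met as soon as each such \<open>p\<close> has a nontrivial orbit whose closed walk
  has weight zero: weights of orbits divide the product over \<open>S\<close>.\<close>

lemma (in weighted_digraph) mat_det_single_cycles:
  assumes "finite S" and "S \<subseteq> V" and diag: "\<And>x. x \<in> S \<Longrightarrow> a x x = \<one>"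
    and other: "\<And>p. p permutes S \<Longrightarrow> p \<noteq> id \<Longrightarrow> p \<notin> single_cycles S \<Longrightarrow> (\<Otimes>x\<in>S. a x (p x)) = \<zero>"
  shows "mat_det R S a = \<one> \<oplus> (\<Oplus>p\<in>single_cycles S. add_pow R (sign p) (\<Otimes>x\<in>S. a x (p x)))"
proof -
  let ?P = "{p. p permutes S}"
  let ?f = "\<lambda>p. add_pow R (sign p) (\<Otimes>x\<in>S. a x (p x))"
  have closed: "?f \<in> ?P \<rightarrow> carrier R"
    using assms(2) by (auto intro!: add.int_pow_closed)
  have fin: "finite ?P"
    using assms(1) by (rule finite_permutations)
  have P: "?P = insert id (?P - {id})"
    using permutes_id by auto
  have "(\<Otimes>x\<in>S. a x (id x)) = \<one>"
    using diag by (simp add: finprod_one_eqI)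
  then have id: "?f id = \<one>"
    by (simp add: add.int_pow_1)
  have zero: "?f p = \<zero>" if "p \<in> ?P - {id} - single_cycles S" for p
    using other that by (simp add: add.int_pow_one)
  have sub: "single_cycles S \<subseteq> ?P - {id}"
    by (auto simp: single_cycles_def)
  have "mat_det R S a = (\<Oplus>p\<in>insert id (?P - {id}). ?f p)"
    by (simp only: mat_det_def P [symmetric])
  also have "\<dots> = \<one> \<oplus> (\<Oplus>p\<in>?P - {id}. ?f p)"
    using fin closed id by (subst finsum_insert) auto
  also have "(\<Oplus>p\<in>?P - {id}. ?f p) = (\<Oplus>p\<in>single_cycles S. ?f p)"
    by (intro add.finprod_mono_neutral_cong_right) (use fin closed zero sub in auto)
  finally show ?thesis .
qed

section \<open>Vanishing of closed walks\<close>

lemma (in ring) finsum_in_ideal: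
  assumes "ideal I R" and "\<And>x. x \<in> X \<Longrightarrow> f x \<in> I"
  shows "(\<Oplus>x\<in>X. f x) \<in> I"
proof -
  interpret ideal I R by fact
  show ?thesis
    using assms(2) by (induction X rule: infinite_finite_induct) (auto simp: Pi_def)
qed

text \<open>The element \<open>x = s p\<close> satisfies \<open>x t = x\<^sup>2 + r\<close>, where \<open>t\<close> is the total sum and \<open>r\<close> collects
  the products of \<open>x\<close> with the other summands.  Since \<open>t\<close> lies in \<open>I\<close> and \<open>r\<close> in its square, this is
  an equation of integral dependence of degree 2.\<close>

lemma (in cring) summand_in_integrally_closed_ideal:
  assumes "ideal I R" and "integrally_closed R I" and "finite X"
    and closed: "\<And>p. p \<in> X \<Longrightarrow> s p \<in> carrier R"
    and total: "(\<Oplus>p\<in>X. s p) \<in> I"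
    and products: "\<And>p q. p \<in> X \<Longrightarrow> q \<in> X \<Longrightarrow> p \<noteq> q \<Longrightarrow> s p \<otimes> s q \<in> ideal_prod R I I"
    and "p \<in> X"
  shows "s p \<in> I"
proof -
  interpret I: ideal I R by fact
  interpret II: ideal "ideal_prod R I I" R
    by (rule ideal_prod_is_ideal[OF assms(1,1)])
  define x where "x = s p"
  define t where "t = (\<Oplus>q\<in>X. s q)"
  define r where "r = (\<Oplus>q\<in>X - {p}. x \<otimes> s q)"
  have x: "x \<in> carrier R" and t: "t \<in> I" "t \<in> carrier R"
    using assms I.Icarr by (auto simp: x_def t_def)
  have r: "r \<in> ideal_prod R I I"
    unfolding r_def x_def using products assms(7) by (intro finsum_in_ideal II.ideal_axioms) auto
  have rc: "r \<in> carrier R"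
    using r II.Icarr by blast
  have "x \<otimes> t = (\<Oplus>q\<in>insert p (X - {p}). x \<otimes> s q)"
    unfolding t_def using assms(3,7) closed x by (subst finsum_rdistr) (auto simp: insert_absorb)
  also have "\<dots> = x \<otimes> x \<oplus> r"
    unfolding r_def using assms(3,7) closed x by (subst finsum_insert) (auto simp: x_def)
  finally have quad: "x \<otimes> t = x \<otimes> x \<oplus> r" .
  \<comment> \<open>These are the coefficients of the equation \<open>X\<^sup>2 - t X + r = 0\<close>.\<close>
  define c where "c = (\<lambda>j::nat. if j = 1 then \<ominus> t else r)"
  have cc: "c j \<in> carrier R" for j
    using t rc by (simp add: c_def)
  have unit: "ideal_prod R (carrier R) I = I"
    using ideal_prod_one[OF assms(1)] ideal_prod_commute[OF oneideal assms(1)] by simp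
  have two: "{1..2::nat} = {1, 2}"
    by auto
  have "integral_over_ideal R I x"
    unfolding integral_over_ideal_def
  proof (intro exI conjI ballI)
    show "(2::nat) > 0" by simp
    show "c j \<in> I [^]\<^bsub>ideals_set R\<^esub> j" if "j \<in> {1..2}" for j
      using that t r I.a_inv_closed unfolding two
      by (auto simp: c_def numeral_2_eq_2 nat_pow_def ideals_set_def unit)
    have "(\<Oplus>j\<in>{1..2}. c j \<otimes> x [^] (2 - j)) = \<ominus> t \<otimes> x \<oplus> r"
      unfolding two using cc x rc t by (simp add: c_def)
    moreover have "x [^] (2::nat) = t \<otimes> x \<ominus> r"
      using quad x t rc by (simp add: numeral_2_eq_2 m_comm[of t] a_minus_def a_assoc r_neg)
    moreover have "u \<ominus> r \<oplus> (\<ominus> u \<oplus> r) = \<zero>" if "u \<in> carrier R" for u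
      using that rc by algebra
    ultimately show "x [^] (2::nat) \<oplus> (\<Oplus>j\<in>{1..2}. c j \<otimes> x [^] (2 - j)) = \<zero>"
      using x t by (simp add: l_minus)
  qed
  then show ?thesis
    using assms(2) x unfolding integrally_closed_def integral_closure_def x_def by auto
qed

text \<open>The induction runs over the quotient, but the case of a cycle through distinct vertices is
  settled for a lift of the entries to \<open>D\<close>: the products of two cycles are needed in the square
  of \<open>I\<close>, which the quotient cannot see.\<close>

theorem closed_walk_weight_zero:
  fixes D :: "('a, 'b) ring_scheme" and A :: "'v \<Rightarrow> 'v \<Rightarrow> 'a set"
  assumes "cring D" and "ideal I D" and "integrally_closed D I"
    and "weighted_digraph (D Quot I) V A"
    and minors: "\<And>S. finite S \<Longrightarrow> S \<subseteq> V \<Longrightarrow> mat_det (D Quot I) S A = \<one>\<^bsub>D Quot I\<^esub>"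
    and "loopless_closed ws" and "set ws \<subseteq> V"
  shows "closed_weight (D Quot I) A ws = \<zero>\<^bsub>D Quot I\<^esub>"
proof -
  interpret D: cring D by fact
  interpret I: ideal I D by fact
  let ?R = "D Quot I"
  define h where "h = a_r_coset D I"
  interpret R: weighted_digraph ?R V A by fact
  interpret h: ring_hom_cring D ?R h
    unfolding h_def by (rule I.rcos_ring_hom_cring[OF assms(1)])
  have kernel: "h x = \<zero>\<^bsub>?R\<^esub> \<longleftrightarrow> x \<in> I" if "x \<in> carrier D" for x
    using that I.a_rcos_const[of x] D.a_coset_join1[of I x] I.a_subgroup
    by (auto simp: h_def FactRing_def)
  have "\<exists>d. d \<in> carrier D \<and> h d = A x y" if "x \<in> V" "y \<in> V" for x y
    using R.weight_closed[OF that] by (auto simp: FactRing_def A_RCOSETS_def' h_def)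
  then obtain a where a: "\<And>x y. x \<in> V \<Longrightarrow> y \<in> V \<Longrightarrow> a x y \<in> carrier D \<and> h (a x y) = A x y"
    by metis
  interpret D: weighted_digraph D V a
    using a by unfold_locales auto
  have h_path: "h (path_weight D a us) = path_weight ?R A us" if "set us \<subseteq> V" for us
    using that by (induction us rule: induct_list012) (auto simp: a)
  have in_ideal: "closed_weight D a us \<in> I \<longleftrightarrow> closed_weight ?R A us = \<zero>\<^bsub>?R\<^esub>"
    if "us \<noteq> []" "set us \<subseteq> V" for us
    using that h_path[of "us @ [hd us]"] kernel[of "closed_weight D a us"] D.closed_weight_closed[of us]
    by (simp add: closed_weight_def subset_iff)
  have h_permutation: "h (\<Otimes>\<^bsub>D\<^esub>x\<in>S. a x (p x)) = (\<Otimes>\<^bsub>?R\<^esub>x\<in>S. A x (p x))"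
    if "p permutes S" "S \<subseteq> V" for p S
  proof -
    have V: "p x \<in> V" if "x \<in> S" for x
      using that permutes_in_image[OF \<open>p permutes S\<close>] \<open>S \<subseteq> V\<close> by auto
    then have "(\<lambda>x. a x (p x)) \<in> S \<rightarrow> carrier D"
      using a that by auto
    then have "h (\<Otimes>\<^bsub>D\<^esub>x\<in>S. a x (p x)) = (\<Otimes>\<^bsub>?R\<^esub>x\<in>S. (h \<circ> (\<lambda>x. a x (p x))) x)"
      by (rule h.hom_finprod)
    also have "\<dots> = (\<Otimes>\<^bsub>?R\<^esub>x\<in>S. A x (p x))"
      using a V that(2) by (intro R.finprod_cong') (auto intro!: R.weight_closed)
    finally show ?thesis .
  qed
  show ?thesis
    using assms(6,7)
  proof (induction "length ws" arbitrary: ws rule: less_induct)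
    case less
    have ne: "ws \<noteq> []"
      using less.prems by (simp add: loopless_closed_def)
    show ?case
    proof (cases "distinct ws")
      case False
      then obtain us vs where uv: "loopless_closed us" "loopless_closed vs"
        "set us \<subseteq> set ws" "set vs \<subseteq> set ws" "length us + length vs = length ws"
        "closed_weight ?R A ws = closed_weight ?R A us \<otimes>\<^bsub>?R\<^esub> closed_weight ?R A vs"
        using R.loopless_closed_decompose less.prems by metis
      have "us \<noteq> []" "vs \<noteq> []"
        using uv by (auto simp: loopless_closed_def)
      then have "length us < length ws"
        using uv(5) by (cases vs) auto
      then show ?thesis
        using less.hyps[of us] uv less.prems \<open>vs \<noteq> []\<close> by simp
    next
      case True
      define S where "S = set ws"
      have S: "finite S" "S \<subseteq> V" "card S = length ws"
        using True less.prems by (auto simp: S_def distinct_card)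
      have short: "closed_weight ?R A us = \<zero>\<^bsub>?R\<^esub>"
        if "loopless_closed us" "set us \<subseteq> S" "length us < card S" for us
        using less.hyps[of us] that S by auto
      have short_D: "closed_weight D a us \<in> I"
        if "loopless_closed us" "set us \<subseteq> S" "length us < card S" for us
        using short[OF that] in_ideal[of us] that S by (auto simp: loopless_closed_def)
      let ?X = "single_cycles S"
      let ?w = "\<lambda>p. \<Otimes>\<^bsub>D\<^esub>x\<in>S. a x (p x)"
      let ?s = "\<lambda>p. add_pow D (sign p) (?w p)"
      have X: "finite ?X" "\<And>p. p \<in> ?X \<Longrightarrow> p permutes S"
        using finite_subset[OF _ finite_permutations[OF S(1)], of ?X] by (auto simp: single_cycles_def)
      have wc: "?w p \<in> carrier D" if "p \<in> ?X" for p
        using X(2)[OF that] S(2) by simp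
      have sc: "?s p \<in> carrier D" if "p \<in> ?X" for p
        using wc[OF that] by (rule D.add.int_pow_closed)
      have other: "(\<Otimes>\<^bsub>?R\<^esub>x\<in>S. A x (p x)) = \<zero>\<^bsub>?R\<^esub>"
        if p: "p permutes S" "p \<noteq> id" "p \<notin> ?X" for p
      proof -
        obtain x where x: "p x \<noteq> x" "set (support p x) \<noteq> S"
          using p by (auto simp: single_cycles_def simp del: set_map)
        then have xS: "x \<in> S"
          using p(1) by (auto simp: permutes_def)
        have perm: "permutation p"
          using p(1) S(1) permutation_permutes by blast
        have sub: "set (support p x) \<subset> S"
          using set_support_subset[OF p(1) xS] x(2) by blast
        then have "card (set (support p x)) < card S"
          using S(1) by (rule psubset_card_mono[rotated])
        then have "length (support p x) < card S"
          using distinct_card[OF cycle_of_permutation[OF perm, of x]] by (simp del: set_map)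
        then have "closed_weight ?R A (support p x) = \<zero>\<^bsub>?R\<^esub>"
          using short loopless_closed_support[of p x] perm x(1) sub by blast
        then show ?thesis
          using R.permutation_weight_factor[OF p(1) S(1,2) xS] by auto
      qed
      have "A x x = \<one>\<^bsub>?R\<^esub>" if "x \<in> S" for x
        using minors[of "{x}"] mat_det_singleton[OF assms(4), of x] that S(2) by auto
      then have det: "\<one>\<^bsub>?R\<^esub> = \<one>\<^bsub>?R\<^esub> \<oplus>\<^bsub>?R\<^esub> (\<Oplus>\<^bsub>?R\<^esub>p\<in>?X. add_pow ?R (sign p) (\<Otimes>\<^bsub>?R\<^esub>x\<in>S. A x (p x)))"
        using R.mat_det_single_cycles[OF S(1,2)] other minors[OF S(1,2)] by simp
      have h_s: "h (?s p) = add_pow ?R (sign p) (\<Otimes>\<^bsub>?R\<^esub>x\<in>S. A x (p x))" if "p \<in> ?X" for p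
      proof (cases p rule: sign_cases)
        case even
        then show ?thesis
          using h_permutation[OF X(2)[OF that] S(2)] wc[OF that] X(2)[OF that] S(2)
          by (simp add: D.add.int_pow_1 R.add.int_pow_1)
      next
        case odd
        then show ?thesis
          using h_permutation[OF X(2)[OF that] S(2)] wc[OF that] X(2)[OF that] S(2)
          by (simp add: D.add.int_pow_neg R.add.int_pow_neg D.add.int_pow_1 R.add.int_pow_1)
      qed
      have "h (\<Oplus>\<^bsub>D\<^esub>p\<in>?X. ?s p) = (\<Oplus>\<^bsub>?R\<^esub>p\<in>?X. (h \<circ> ?s) p)"
        using sc by (intro h.hom_finsum) auto
      also have "\<dots> = (\<Oplus>\<^bsub>?R\<^esub>p\<in>?X. add_pow ?R (sign p) (\<Otimes>\<^bsub>?R\<^esub>x\<in>S. A x (p x)))"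
        using h_s X(2) S(2) by (intro R.finsum_cong') (auto intro!: R.add.int_pow_closed)
      also have "\<dots> = \<zero>\<^bsub>?R\<^esub>"
        using det X(2) S(2)
        by (intro R.add.l_cancel_one'[THEN iffD1, of "\<one>\<^bsub>?R\<^esub>"]) (auto intro!: R.finsum_closed R.add.int_pow_closed)
      finally have total: "(\<Oplus>\<^bsub>D\<^esub>p\<in>?X. ?s p) \<in> I"
        using kernel[of "\<Oplus>\<^bsub>D\<^esub>p\<in>?X. ?s p"] sc by (auto intro!: D.finsum_closed)
      \<comment> \<open>Signs do not affect membership, an ideal being closed under negation.\<close>
      have products: "?s p \<otimes>\<^bsub>D\<^esub> ?s q \<in> ideal_prod D I I" if "p \<in> ?X" "q \<in> ?X" "p \<noteq> q" for p q
      proof -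
        interpret II: ideal "ideal_prod D I I" D
          by (rule D.ideal_prod_is_ideal[OF assms(2,2)])
        have "?w p \<otimes>\<^bsub>D\<^esub> ?w q \<in> ideal_prod D I I"
          using D.distinct_single_cycles_weight_product[OF assms(2) S(1,2) short_D that] by simp
        then have "?s p \<otimes>\<^bsub>D\<^esub> ?s q \<in> ideal_prod D I I"
          using wc[OF that(1)] wc[OF that(2)]
          by (cases p rule: sign_cases; cases q rule: sign_cases)
            (simp_all add: D.add.int_pow_neg D.add.int_pow_1 D.l_minus D.r_minus)
        then show ?thesis .
      qed
      \<comment> \<open>The given walk is the orbit of one of the full cycles.\<close>
      define c where "c = cycle_of_list ws"
      have c_rotate: "map c ws = rotate1 ws"
        using cyclic_rotation[OF True, of 1] by (simp add: c_def)
      have weight_c: "?w c = closed_weight D a ws"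
        using D.closed_weight_cycle[OF True ne less.prems(2) c_rotate] by (simp add: S_def)
      have "length ws > 1"
        using less.prems(1) ne by (cases ws rule: remdups_adj.cases) (auto simp: loopless_closed_def)
      then have cX: "c \<in> ?X"
        unfolding c_def S_def by (rule cycle_of_list_single_cycle[OF True])
      have "?s c \<in> I"
        by (rule D.summand_in_integrally_closed_ideal[OF assms(2,3) X(1) sc total products cX])
      then have "?w c \<in> I"
        using wc[OF cX] I.a_inv_closed[of "?s c"]
        by (cases c rule: sign_cases) (simp_all add: D.add.int_pow_neg D.add.int_pow_1)
      then show ?thesis
        using in_ideal[OF ne less.prems(2)] by (simp add: weight_c)
    qed
  qed
qed

section \<open>The monoid of matrices\<close>

lemma mat_mult_entry:
  "x \<in> V \<Longrightarrow> y \<in> V \<Longrightarrow>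
    (B \<otimes>\<^bsub>mat_monoid R V\<^esub> C) x y = (\<Oplus>\<^bsub>R\<^esub>k\<in>V. B x k \<otimes>\<^bsub>R\<^esub> C k y)"
  by (simp add: mat_monoid_def)

lemma mat_one_entry:
  "x \<in> V \<Longrightarrow> y \<in> V \<Longrightarrow> \<one>\<^bsub>mat_monoid R V\<^esub> x y = (if x = y then \<one>\<^bsub>R\<^esub> else \<zero>\<^bsub>R\<^esub>)"
  by (simp add: mat_monoid_def)

lemma mat_entry_closed:
  "B \<in> carrier (mat_monoid R V) \<Longrightarrow> x \<in> V \<Longrightarrow> y \<in> V \<Longrightarrow> B x y \<in> carrier R"
  by (auto simp: mat_monoid_def PiE_def Pi_def)

lemma mat_eqI:
  assumes "B \<in> carrier (mat_monoid R V)" and "C \<in> carrier (mat_monoid R V)"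
    and "\<And>x y. x \<in> V \<Longrightarrow> y \<in> V \<Longrightarrow> B x y = C x y"
  shows "B = C"
proof (rule PiE_ext)
  show "B \<in> V \<rightarrow>\<^sub>E (V \<rightarrow>\<^sub>E carrier R)" "C \<in> V \<rightarrow>\<^sub>E (V \<rightarrow>\<^sub>E carrier R)"
    using assms(1,2) by (simp_all add: mat_monoid_def)
  then show "B x = C x" if "x \<in> V" for x
    using that assms(3) by (intro PiE_ext[of "B x" V "\<lambda>_. carrier R"]) auto
qed

lemma (in cring) monoid_mat_monoid:
  assumes "finite V"
  shows "monoid (mat_monoid R V)"
proof
  let ?M = "mat_monoid R V"
  note entry = mat_entry_closed[where R = R and V = V]
  show one: "\<one>\<^bsub>?M\<^esub> \<in> carrier ?M"
    by (auto simp: mat_monoid_def)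
  show closed: "B \<otimes>\<^bsub>?M\<^esub> C \<in> carrier ?M" if "B \<in> carrier ?M" "C \<in> carrier ?M" for B C
    using entry[OF that(1)] entry[OF that(2)]
    by (simp add: mat_monoid_def)
  show "B \<otimes>\<^bsub>?M\<^esub> C \<otimes>\<^bsub>?M\<^esub> E = B \<otimes>\<^bsub>?M\<^esub> (C \<otimes>\<^bsub>?M\<^esub> E)"
    if M: "B \<in> carrier ?M" "C \<in> carrier ?M" "E \<in> carrier ?M" for B C E
  proof -
    have "(\<Oplus>l\<in>V. (B \<otimes>\<^bsub>?M\<^esub> C) i l \<otimes> E l j) = (\<Oplus>k\<in>V. B i k \<otimes> (C \<otimes>\<^bsub>?M\<^esub> E) k j)"
      if "i \<in> V" "j \<in> V" for i j
    proof -
      have "(\<Oplus>l\<in>V. (B \<otimes>\<^bsub>?M\<^esub> C) i l \<otimes> E l j) = (\<Oplus>l\<in>V. (\<Oplus>k\<in>V. B i k \<otimes> C k l) \<otimes> E l j)"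
        using that entry M by (intro finsum_cong') (auto intro!: finsum_closed simp: mat_mult_entry)
      also have "\<dots> = (\<Oplus>l\<in>V. \<Oplus>k\<in>V. B i k \<otimes> C k l \<otimes> E l j)"
        using assms that entry M by (intro finsum_cong' finsum_ldistr) (auto intro!: finsum_closed)
      also have "\<dots> = (\<Oplus>k\<in>V. \<Oplus>l\<in>V. B i k \<otimes> C k l \<otimes> E l j)"
        using assms that entry M by (intro finsum_finsum_swap) auto
      also have "\<dots> = (\<Oplus>k\<in>V. \<Oplus>l\<in>V. B i k \<otimes> (C k l \<otimes> E l j))"
        using that entry M by (intro finsum_cong') (auto intro!: finsum_closed finsum_cong' m_assoc)
      also have "\<dots> = (\<Oplus>k\<in>V. B i k \<otimes> (\<Oplus>l\<in>V. C k l \<otimes> E l j))"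
        using assms that entry M
        by (intro finsum_cong' finsum_rdistr [symmetric]) (auto intro!: finsum_closed)
      also have "\<dots> = (\<Oplus>k\<in>V. B i k \<otimes> (C \<otimes>\<^bsub>?M\<^esub> E) k j)"
        using that entry M closed by (intro finsum_cong') (auto simp: mat_mult_entry)
      finally show ?thesis .
    qed
    then show ?thesis
      using closed M by (intro mat_eqI[of _ R V]) (auto simp: mat_mult_entry)
  qed
  have unit: "(\<Oplus>k\<in>V. \<one>\<^bsub>?M\<^esub> i k \<otimes> B k j) = B i j" "(\<Oplus>k\<in>V. B i k \<otimes> \<one>\<^bsub>?M\<^esub> k j) = B i j"
    if B: "B \<in> carrier ?M" and "i \<in> V" "j \<in> V" for B i j
  proof -
    have "(\<Oplus>k\<in>V. \<one>\<^bsub>?M\<^esub> i k \<otimes> B k j) = (\<Oplus>k\<in>V. if i = k then B k j else \<zero>)"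
      using entry[OF B] that by (intro finsum_cong') (auto simp: mat_one_entry)
    then show "(\<Oplus>k\<in>V. \<one>\<^bsub>?M\<^esub> i k \<otimes> B k j) = B i j"
      using entry[OF B] that assms by (simp add: finsum_singleton Pi_def)
    have "(\<Oplus>k\<in>V. B i k \<otimes> \<one>\<^bsub>?M\<^esub> k j) = (\<Oplus>k\<in>V. if j = k then B i k else \<zero>)"
      using entry[OF B] that by (intro finsum_cong') (auto simp: mat_one_entry)
    then show "(\<Oplus>k\<in>V. B i k \<otimes> \<one>\<^bsub>?M\<^esub> k j) = B i j"
      using entry[OF B] that assms by (simp add: finsum_singleton Pi_def)
  qed
  show "\<one>\<^bsub>?M\<^esub> \<otimes>\<^bsub>?M\<^esub> B = B" "B \<otimes>\<^bsub>?M\<^esub> \<one>\<^bsub>?M\<^esub> = B" if B: "B \<in> carrier ?M" for B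
    using closed[OF one B] closed[OF B one] B unit[OF B]
    by (auto intro!: mat_eqI[of _ R V] simp: mat_mult_entry)
qed

section \<open>Unipotent matrices with entries in a system of ideals\<close>

text \<open>The entries in position \<open>(x, y)\<close> are confined to an ideal \<open>J x y\<close>.  The last two conditions say that products
  along a walk stay in the system and that going from \<open>x\<close> to \<open>y \<noteq> x\<close> and back gives zero, as for
  strictly triangular matrices.  Over a ring with zero divisors the index set need not admit an order
  that makes the matrices triangular: \<open>J x y\<close> and \<open>J y x\<close> can be nonzero ideals that annihilate
  each other.\<close>

locale acyclic_ideal_system = cring R for R (structure) +
  fixes V :: "'v set" and J :: "'v \<Rightarrow> 'v \<Rightarrow> 'a set"
  assumes finite_V: "finite V"
    and J_ideal: "\<And>x y. x \<in> V \<Longrightarrow> y \<in> V \<Longrightarrow> ideal (J x y) R"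
    and J_one: "\<And>x. x \<in> V \<Longrightarrow> \<one> \<in> J x x"
    and J_mult: "\<And>x y z s t. x \<in> V \<Longrightarrow> y \<in> V \<Longrightarrow> z \<in> V \<Longrightarrow> s \<in> J x y \<Longrightarrow> t \<in> J y z \<Longrightarrow> s \<otimes> t \<in> J x z"
    and J_zero: "\<And>x y s t. x \<in> V \<Longrightarrow> y \<in> V \<Longrightarrow> x \<noteq> y \<Longrightarrow> s \<in> J x y \<Longrightarrow> t \<in> J y x \<Longrightarrow> s \<otimes> t = \<zero>"
begin

definition unipotents :: "('v \<Rightarrow> 'v \<Rightarrow> 'a) set"
  where "unipotents =
    {B \<in> carrier (mat_monoid R V). (\<forall>x\<in>V. B x x = \<one>) \<and> (\<forall>x\<in>V. \<forall>y\<in>V. B x y \<in> J x y)}"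

lemma J_carrier: "x \<in> V \<Longrightarrow> y \<in> V \<Longrightarrow> s \<in> J x y \<Longrightarrow> s \<in> carrier R"
  using ideal.Icarr[OF J_ideal] by blast

lemma unipotentsD:
  assumes "B \<in> unipotents"
  shows "B \<in> carrier (mat_monoid R V)" and "x \<in> V \<Longrightarrow> B x x = \<one>"
    and "x \<in> V \<Longrightarrow> y \<in> V \<Longrightarrow> B x y \<in> J x y"
    and "x \<in> V \<Longrightarrow> y \<in> V \<Longrightarrow> B x y \<in> carrier R"
  using assms J_carrier by (auto simp: unipotents_def)

lemma unipotents_one: "\<one>\<^bsub>mat_monoid R V\<^esub> \<in> unipotents"
  using monoid.one_closed[OF monoid_mat_monoid[OF finite_V]] J_one
    additive_subgroup.zero_closed[OF ideal.axioms(1)[OF J_ideal]]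
  by (auto simp: unipotents_def) (auto simp: mat_monoid_def)

lemma unipotents_mult:
  assumes B: "B \<in> unipotents" and C: "C \<in> unipotents"
  shows "B \<otimes>\<^bsub>mat_monoid R V\<^esub> C \<in> unipotents"
proof -
  have closed: "B x k \<otimes> C k y \<in> carrier R" if "x \<in> V" "k \<in> V" "y \<in> V" for x y k
    using unipotentsD(4)[OF B] unipotentsD(4)[OF C] that by simp
  have "(\<Oplus>k\<in>V. B x k \<otimes> C k y) \<in> J x y" if "x \<in> V" "y \<in> V" for x y
    using that unipotentsD(3)[OF B] unipotentsD(3)[OF C] J_mult
    by (intro finsum_in_ideal J_ideal) auto
  moreover have "(\<Oplus>k\<in>V. B x k \<otimes> C k x) = \<one>" if "x \<in> V" for x
  proof -
    have "(\<Oplus>k\<in>V. B x k \<otimes> C k x) = (\<Oplus>k\<in>V. if x = k then \<one> else \<zero>)"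
      using that unipotentsD(2,3)[OF B] unipotentsD(2,3)[OF C] J_zero
      by (intro finsum_cong') auto
    then show ?thesis
      using that finite_V by (simp add: finsum_singleton)
  qed
  ultimately show ?thesis
    using monoid.m_closed[OF monoid_mat_monoid[OF finite_V] unipotentsD(1)[OF B] unipotentsD(1)[OF C]]
    by (simp add: unipotents_def mat_mult_entry)
qed

text \<open>The elementary matrix that subtracts \<open>C t y\<close> times column \<open>t\<close> from each column \<open>y \<noteq> t\<close> clears
  row \<open>t\<close>.  It has its entries in the system because \<open>C\<close> has; the diagonal of \<open>C\<close> is not disturbed
  as \<open>C x t C t x = 0\<close>, and a row that is already clear stays so because its entry in column \<open>t\<close>
  is zero.\<close>

lemma unipotents_clear_row:
  assumes C: "C \<in> unipotents" and t: "t \<in> V" and "T \<subseteq> V"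
    and rows: "\<And>x y. x \<in> T \<Longrightarrow> y \<in> V \<Longrightarrow> x \<noteq> y \<Longrightarrow> C x y = \<zero>"
  shows "\<exists>E\<in>unipotents. \<forall>x\<in>insert t T. \<forall>y\<in>V. x \<noteq> y \<longrightarrow> (C \<otimes>\<^bsub>mat_monoid R V\<^esub> E) x y = \<zero>"
proof -
  define E where "E = (\<lambda>x\<in>V. \<lambda>y\<in>V. if x = y then \<one> else if x = t then \<ominus> C t y else \<zero>)"
  have E: "E \<in> unipotents"
    using t unipotentsD(3,4)[OF C] J_one additive_subgroup.zero_closed[OF ideal.axioms(1)[OF J_ideal]]
      additive_subgroup.a_inv_closed[OF ideal.axioms(1)[OF J_ideal]]
    by (auto simp: unipotents_def mat_monoid_def E_def)
  have "(C \<otimes>\<^bsub>mat_monoid R V\<^esub> E) x y = \<zero>"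
    if x: "x \<in> insert t T" and y: "y \<in> V" "x \<noteq> y" for x y
  proof -
    have xV: "x \<in> V"
      using x t assms(3) by auto
    have cancel: "C x y \<ominus> C x t \<otimes> C t y = \<zero>" if "y \<noteq> t"
    proof (cases "x = t")
      case True
      then show ?thesis
        using unipotentsD(2,4)[OF C] t y by (simp add: a_minus_def r_neg)
    next
      case False
      then show ?thesis
        using x y t rows unipotentsD(4)[OF C] by (simp add: a_minus_def)
    qed
    have closed: "C x k \<otimes> E k y \<in> carrier R" if "k \<in> V" for k
      using unipotentsD(4)[OF C] unipotentsD(4)[OF E] that xV y by simp
    \<comment> \<open>Column \<open>y\<close> of \<open>E\<close> is zero outside the rows \<open>t\<close> and \<open>y\<close>.\<close>
    have "(\<Oplus>k\<in>V. C x k \<otimes> E k y) = (\<Oplus>k\<in>{t, y}. C x k \<otimes> E k y)"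
      using finite_V t y closed unipotentsD(4)[OF C] xV
      by (intro add.finprod_mono_neutral_cong_right) (auto simp: E_def)
    also have "\<dots> = \<zero>"
    proof (cases "y = t")
      case True
      then show ?thesis
        using x y t closed[OF t] rows unipotentsD(2)[OF E t] by auto
    next
      case False
      then show ?thesis
        using cancel closed[of t] closed[of y] t y xV unipotentsD(4)[OF C]
        by (simp add: E_def a_comm r_minus a_minus_def)
    qed
    finally show ?thesis
      using xV y by (simp add: mat_mult_entry)
  qed
  with E show ?thesis by blast
qed

text \<open>Clearing all rows one after the other multiplies \<open>B\<close> from the right until the identity
  matrix is reached.\<close>

lemma unipotents_right_inverse:
  assumes B: "B \<in> unipotents"
  shows "\<exists>X\<in>unipotents. B \<otimes>\<^bsub>mat_monoid R V\<^esub> X = \<one>\<^bsub>mat_monoid R V\<^esub>"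
proof -
  let ?M = "mat_monoid R V"
  interpret M: monoid ?M
    by (rule monoid_mat_monoid[OF finite_V])
  have "\<exists>X\<in>unipotents. \<forall>x\<in>T. \<forall>y\<in>V. x \<noteq> y \<longrightarrow> (B \<otimes>\<^bsub>?M\<^esub> X) x y = \<zero>" if "T \<subseteq> V" for T
    using finite_subset[OF that finite_V] that
  proof (induction T rule: finite_induct)
    case empty
    then show ?case using unipotents_one by blast
  next
    case (insert t T)
    then obtain X where X: "X \<in> unipotents" "\<And>x y. x \<in> T \<Longrightarrow> y \<in> V \<Longrightarrow> x \<noteq> y \<Longrightarrow> (B \<otimes>\<^bsub>?M\<^esub> X) x y = \<zero>"
      by (meson insert_subset)
    have tT: "t \<in> V" "T \<subseteq> V"
      using insert.prems by simp_all
    obtain E where E: "E \<in> unipotents" "\<forall>x\<in>insert t T. \<forall>y\<in>V. x \<noteq> y \<longrightarrow> (B \<otimes>\<^bsub>?M\<^esub> X \<otimes>\<^bsub>?M\<^esub> E) x y = \<zero>"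
      using unipotents_clear_row[OF unipotents_mult[OF B X(1)] tT X(2)] by blast
    have "B \<otimes>\<^bsub>?M\<^esub> X \<otimes>\<^bsub>?M\<^esub> E = B \<otimes>\<^bsub>?M\<^esub> (X \<otimes>\<^bsub>?M\<^esub> E)"
      by (rule M.m_assoc[OF unipotentsD(1)[OF B] unipotentsD(1)[OF X(1)] unipotentsD(1)[OF E(1)]])
    with E(2) show ?case
      by (intro bexI[OF _ unipotents_mult[OF X(1) E(1)]]) simp
  qed
  from this[OF subset_refl] obtain X
    where X: "X \<in> unipotents" "\<And>x y. x \<in> V \<Longrightarrow> y \<in> V \<Longrightarrow> x \<noteq> y \<Longrightarrow> (B \<otimes>\<^bsub>?M\<^esub> X) x y = \<zero>"
    by blast
  have BX: "B \<otimes>\<^bsub>?M\<^esub> X \<in> unipotents"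
    by (rule unipotents_mult[OF B X(1)])
  have "B \<otimes>\<^bsub>?M\<^esub> X = \<one>\<^bsub>?M\<^esub>"
  proof (rule mat_eqI[OF unipotentsD(1)[OF BX] M.one_closed])
    show "(B \<otimes>\<^bsub>?M\<^esub> X) x y = \<one>\<^bsub>?M\<^esub> x y" if "x \<in> V" "y \<in> V" for x y
      using that X(2) unipotentsD(2)[OF BX, of x] by (cases "x = y") (simp_all add: mat_one_entry)
  qed
  with X(1) show ?thesis by blast
qed

text \<open>In a monoid, right inverses that are themselves right invertible are two-sided.\<close>

lemma unipotents_inv:
  assumes B: "B \<in> unipotents"
  shows "inv\<^bsub>mat_monoid R V\<^esub> B \<in> unipotents"
proof -
  let ?M = "mat_monoid R V"
  interpret M: monoid ?M
    by (rule monoid_mat_monoid[OF finite_V])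
  obtain X where X: "X \<in> unipotents" "B \<otimes>\<^bsub>?M\<^esub> X = \<one>\<^bsub>?M\<^esub>"
    using unipotents_right_inverse[OF B] by blast
  obtain Y where Y: "Y \<in> unipotents" "X \<otimes>\<^bsub>?M\<^esub> Y = \<one>\<^bsub>?M\<^esub>"
    using unipotents_right_inverse[OF X(1)] by blast
  note c = unipotentsD(1)[OF B] unipotentsD(1)[OF X(1)] unipotentsD(1)[OF Y(1)]
  \<comment> \<open>\<open>X\<close> has the left inverse \<open>B\<close> and the right inverse \<open>Y\<close>.\<close>
  have "B = Y"
    by (rule M.inv_unique[OF X(2) Y(2) c(2,1,3)])
  then have "X = inv\<^bsub>?M\<^esub> B"
    using M.inv_unique'[OF c(1,2) X(2)] Y(2) by simp
  then show ?thesis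
    using X(1) by simp
qed

lemma unipotents_int_pow:
  assumes B: "B \<in> unipotents"
  shows "B [^]\<^bsub>mat_monoid R V\<^esub> (m::int) \<in> unipotents"
proof -
  have nat: "B [^]\<^bsub>mat_monoid R V\<^esub> (k::nat) \<in> unipotents" for k
  proof (induction k)
    case 0
    then show ?case
      unfolding Group.nat_pow_0 by (rule unipotents_one)
  next
    case (Suc k)
    then show ?case
      unfolding Group.nat_pow_Suc by (rule unipotents_mult[OF _ B])
  qed
  then show ?thesis
    unfolding int_pow_def2 using unipotents_inv[OF nat] by presburger
qed

end

lemma (in acyclic_ideal_system) unipotents_weighted_digraph:
  assumes "B \<in> unipotents"
  shows "weighted_digraph R V B"
  using unipotentsD(4)[OF assms] by unfold_locales auto

lemma (in acyclic_ideal_system) path_weight_in_J: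
  assumes "B \<in> unipotents" and "ws \<noteq> []" and "set ws \<subseteq> V"
  shows "path_weight R B ws \<in> J (hd ws) (last ws)"
  using assms(2,3)
proof (induction ws rule: induct_list012)
  case (3 x y ws)
  then have V: "x \<in> V" "y \<in> V" "last (y # ws) \<in> V"
    using last_in_set[of "y # ws"] by auto
  have "path_weight R B (y # ws) \<in> J y (last (y # ws))"
    using 3 by simp
  then show ?case
    using J_mult[OF V unipotentsD(3)[OF assms(1) V(1,2)]] by simp
qed (use J_one in auto)

text \<open>After its first edge from \<open>x\<close> to \<open>y\<close>, the rest of the closed walk lies in \<open>J y x\<close>.\<close>

lemma (in acyclic_ideal_system) unipotents_closed_weight:
  assumes B: "B \<in> unipotents" and ws: "loopless_closed ws" "set ws \<subseteq> V"
  shows "closed_weight R B ws = \<zero>"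
proof -
  obtain x y us where xy: "ws = x # y # us" "x \<noteq> y"
    using ws(1) by (cases ws rule: remdups_adj.cases) (auto simp: loopless_closed_def)
  have V: "x \<in> V" "y \<in> V" "set (y # us @ [x]) \<subseteq> V"
    using ws(2) xy by auto
  have "path_weight R B (y # us @ [x]) \<in> J y x"
    using path_weight_in_J[OF B _ V(3)] by simp
  then have "B x y \<otimes> path_weight R B (y # us @ [x]) = \<zero>"
    by (rule J_zero[OF V(1,2) xy(2) unipotentsD(3)[OF B V(1,2)]])
  then show ?thesis
    by (simp add: closed_weight_def xy)
qed

theorem (in acyclic_ideal_system) unipotents_minor:
  assumes B: "B \<in> unipotents" and S: "S \<subseteq> V"
  shows "mat_det R S B = \<one>"
proof -
  interpret B: weighted_digraph R V B
    by (rule unipotents_weighted_digraph[OF B])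
  have fin: "finite S"
    using S finite_V by (rule finite_subset)
  have zero: "(\<Otimes>x\<in>S. B x (p x)) = \<zero>" if p: "p permutes S" "p \<noteq> id" for p
  proof -
    obtain x where x: "p x \<noteq> x"
      using p(2) by (auto simp: fun_eq_iff)
    then have xS: "x \<in> S"
      using p(1) by (auto simp: permutes_def)
    have perm: "permutation p"
      using p(1) fin permutation_permutes by blast
    have "closed_weight R B (support p x) = \<zero>"
      using unipotents_closed_weight[OF B loopless_closed_support[of p x]] perm x
        set_support_subset[OF p(1) xS] S by blast
    then show ?thesis
      using B.permutation_weight_factor[OF p(1) fin S xS] by auto
  qed
  have "mat_det R S B = \<one> \<oplus> (\<Oplus>p\<in>single_cycles S. add_pow R (sign p) (\<Otimes>x\<in>S. B x (p x)))"
    using zero unipotentsD(2)[OF B] S by (intro B.mat_det_single_cycles fin S) auto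
  also have "(\<Oplus>p\<in>single_cycles S. add_pow R (sign p) (\<Otimes>x\<in>S. B x (p x))) = \<zero>"
    using zero by (intro add.finprod_one_eqI) (auto simp: single_cycles_def add.int_pow_one)
  finally show ?thesis by simp
qed

section \<open>Ideals generated by walk weights\<close>

lemma (in cring) colon_ideal:
  assumes "ideal K R" and "t \<in> carrier R"
  shows "ideal {x \<in> carrier R. x \<otimes> t \<in> K} R"
proof -
  interpret K: ideal K R by fact
  show ?thesis
  proof (rule idealI[OF ring_axioms])
    show "subgroup {x \<in> carrier R. x \<otimes> t \<in> K} (add_monoid R)"
      using assms(2) K.a_inv_closed
      by (auto simp: l_distr l_minus intro!: add.subgroupI simp flip: a_inv_def)
    show "x \<otimes> s \<in> {x \<in> carrier R. x \<otimes> t \<in> K}" "s \<otimes> x \<in> {x \<in> carrier R. x \<otimes> t \<in> K}"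
      if "s \<in> {x \<in> carrier R. x \<otimes> t \<in> K}" "x \<in> carrier R" for s x
      using that assms(2) K.I_l_closed by (auto simp: m_assoc m_comm[of s x])
  qed
qed

text \<open>Membership of products is tested on generators by passing to the ideal quotient of \<open>K\<close>,
  once in each factor.  With \<open>K = 0\<close> this also yields the vanishing of products.\<close>

lemma (in cring) genideal_mult_mem:
  assumes "ideal K R" and S: "S \<subseteq> carrier R" and T: "T \<subseteq> carrier R"
    and "\<And>s t. s \<in> S \<Longrightarrow> t \<in> T \<Longrightarrow> s \<otimes> t \<in> K"
    and "x \<in> genideal R S" and "y \<in> genideal R T"
  shows "x \<otimes> y \<in> K"
proof -
  have "genideal R S \<subseteq> {x \<in> carrier R. x \<otimes> t \<in> K}" if "t \<in> T" for t
    using assms that by (intro genideal_minimal colon_ideal) auto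
  then have xt: "x \<in> carrier R" "x \<otimes> t \<in> K" if "t \<in> T" for t
    using assms(5) that by auto
  have x: "x \<in> carrier R"
    using assms(5) ideal.Icarr[OF genideal_ideal[OF S]] by blast
  have "genideal R T \<subseteq> {y \<in> carrier R. y \<otimes> x \<in> K}"
    using assms(1) T xt x by (intro genideal_minimal colon_ideal) (auto simp: m_comm subset_iff)
  then show ?thesis
    using assms(6) x by (auto simp: m_comm)
qed

text \<open>The walks are loopless so that a walk from \<open>x\<close> to \<open>y\<close> followed by one from \<open>y\<close> to \<open>x\<close>
  is a loopless closed walk.  The one-vertex walk contributes 1 to \<open>path_weights R V a x x\<close>.\<close>

definition path_weights :: "('r, 'm) ring_scheme \<Rightarrow> 'v set \<Rightarrow> ('v \<Rightarrow> 'v \<Rightarrow> 'r) \<Rightarrow> 'v \<Rightarrow> 'v \<Rightarrow> 'r set"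
  where "path_weights R V a x y =
    {path_weight R a ws | ws. ws \<noteq> [] \<and> hd ws = x \<and> last ws = y \<and> set ws \<subseteq> V \<and> distinct_adj ws}"

lemma (in weighted_digraph) path_weights_mult:
  assumes "s \<in> path_weights R V a x y" and "t \<in> path_weights R V a y z"
  shows "s \<otimes> t \<in> path_weights R V a x z"
    and "x \<noteq> y \<Longrightarrow> x = z \<Longrightarrow> \<exists>ws. loopless_closed ws \<and> set ws \<subseteq> V \<and> s \<otimes> t = closed_weight R a ws"
proof -
  obtain us' where us': "s = path_weight R a us'" "us' \<noteq> []" "hd us' = x" "last us' = y"
      "set us' \<subseteq> V" "distinct_adj us'"
    using assms(1) unfolding path_weights_def by blast
  obtain vs' where vs': "t = path_weight R a vs'" "vs' \<noteq> []" "hd vs' = y" "last vs' = z"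
      "set vs' \<subseteq> V" "distinct_adj vs'"
    using assms(2) unfolding path_weights_def by blast
  define us vs where "us = butlast us'" and "vs = tl vs'"
  have eq: "us' = us @ [y]" "vs' = y # vs"
    using append_butlast_last_id[OF us'(2)] us'(4) hd_Cons_tl[OF vs'(2)] vs'(3)
    by (simp_all add: us_def vs_def)
  note us = us'[unfolded eq] and vs = vs'[unfolded eq]
  have st: "s \<otimes> t = path_weight R a (us @ y # vs)"
    using path_weight_join[of us y vs] us(1,5) vs(1,5) by simp
  have adj: "distinct_adj (us @ y # vs)"
    using us(6) vs(6) by (auto simp: distinct_adj_append_iff)
  have hd: "hd (us @ y # vs) = x"
    using us(3) by (cases us) auto
  show "s \<otimes> t \<in> path_weights R V a x z"
    unfolding path_weights_def st using us(5) vs(4,5) adj hd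
    by (intro CollectI exI[of _ "us @ y # vs"]) simp
  assume "x \<noteq> y" "x = z"
  then have "us \<noteq> []" "vs \<noteq> []"
    using us(3) vs(4) by auto
  define ws where "ws = us @ y # butlast vs"
  have "vs = butlast vs @ [x]"
    using \<open>vs \<noteq> []\<close> vs(4) \<open>x = z\<close> append_butlast_last_id[of vs] by simp
  moreover have "hd ws = x"
    using hd \<open>us \<noteq> []\<close> by (simp add: ws_def)
  ultimately have ws: "us @ y # vs = ws @ [hd ws]"
    by (simp add: ws_def)
  have "set ws \<subseteq> V"
    using us(5) vs(5) by (auto simp: ws_def dest: in_set_butlastD)
  moreover have "loopless_closed ws"
    using adj unfolding ws by (simp add: loopless_closed_def) (simp add: ws_def)
  ultimately show "\<exists>ws. loopless_closed ws \<and> set ws \<subseteq> V \<and> s \<otimes> t = closed_weight R a ws"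
    unfolding st ws closed_weight_def by blast
qed

theorem (in weighted_digraph) path_ideals_acyclic:
  assumes "finite V"
    and "\<And>ws. loopless_closed ws \<Longrightarrow> set ws \<subseteq> V \<Longrightarrow> closed_weight R a ws = \<zero>"
  shows "acyclic_ideal_system R V (\<lambda>x y. genideal R (path_weights R V a x y))"
proof (intro acyclic_ideal_system.intro acyclic_ideal_system_axioms.intro)
  show "cring R" "finite V"
    by (rule is_cring assms(1))+
  have sub: "path_weights R V a x y \<subseteq> carrier R" for x y
    by (auto simp: path_weights_def)
  show "ideal (genideal R (path_weights R V a x y)) R" for x y
    by (rule genideal_ideal[OF sub])
  show "\<one> \<in> genideal R (path_weights R V a x x)" if "x \<in> V" for x
  proof -
    have "\<one> \<in> path_weights R V a x x"
      using that by (auto simp: path_weights_def intro!: exI[of _ "[x]"])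
    then show ?thesis
      using genideal_self[OF sub] by blast
  qed
  show "s \<otimes> t \<in> genideal R (path_weights R V a x z)"
    if "s \<in> genideal R (path_weights R V a x y)" "t \<in> genideal R (path_weights R V a y z)" for x y z s t
  proof (rule genideal_mult_mem[OF genideal_ideal[OF sub] sub sub _ that])
    show "u \<otimes> v \<in> genideal R (path_weights R V a x z)"
      if "u \<in> path_weights R V a x y" "v \<in> path_weights R V a y z" for u v
      using path_weights_mult(1)[OF that] genideal_self[OF sub] by blast
  qed
  show "s \<otimes> t = \<zero>"
    if "x \<noteq> y" "s \<in> genideal R (path_weights R V a x y)" "t \<in> genideal R (path_weights R V a y x)" for x y s t
  proof -
    have "s \<otimes> t \<in> {\<zero>}"
    proof (rule genideal_mult_mem[OF zeroideal sub sub _ that(2,3)])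
      show "u \<otimes> v \<in> {\<zero>}" if "u \<in> path_weights R V a x y" "v \<in> path_weights R V a y x" for u v
        using path_weights_mult(2)[OF that \<open>x \<noteq> y\<close> refl] assms(2) by auto
    qed
    then show ?thesis by simp
  qed
qed

section \<open>Powers of 1-principled matrices\<close>

theorem theorem1p2:
  fixes D :: "('a, 'b) ring_scheme" and I :: "'a set"
    and n :: nat and A :: "nat \<Rightarrow> nat \<Rightarrow> 'a set" and m :: int
  assumes "cring D" and "ideal I D" and "integrally_closed D I"
    and "one_principled (D Quot I) n A"
  shows "one_principled (D Quot I) n (A [^]\<^bsub>mat_monoid (D Quot I) {1..n}\<^esub> m)"
proof -
  let ?R = "D Quot I" and ?V = "{1..n}"
  interpret R: cring ?R
    by (rule ideal.quotient_is_cring[OF assms(2,1)])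
  have carrier: "A \<in> carrier (mat_monoid ?R ?V)"
    using assms(4) by (simp add: one_principled_def)
  have graph: "weighted_digraph ?R ?V A"
    using mat_entry_closed[OF carrier] by unfold_locales
  then interpret A: weighted_digraph ?R ?V A .
  have minors: "mat_det ?R S A = \<one>\<^bsub>?R\<^esub>" if "S \<subseteq> ?V" for S
    using assms(4) that mat_det_principal_submatrix[OF graph that] by (simp add: one_principled_def)
  interpret J: acyclic_ideal_system ?R ?V "\<lambda>x y. genideal ?R (path_weights ?R ?V A x y)"
    by (intro A.path_ideals_acyclic closed_walk_weight_zero[OF assms(1-3) graph] minors) auto
  have "A x x = \<one>\<^bsub>?R\<^esub>" if "x \<in> ?V" for x
    using minors[of "{x}"] mat_det_singleton[OF graph that] that by simp
  moreover have "A x y \<in> genideal ?R (path_weights ?R ?V A x y)" if "x \<in> ?V" "y \<in> ?V" for x y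
  proof (cases "x = y")
    case True
    then show ?thesis
      using J.J_one[OF that(1)] calculation[OF that(1)] by simp
  next
    case False
    have "A x y \<in> path_weights ?R ?V A x y"
      unfolding path_weights_def
      using that False A.weight_closed[OF that] by (intro CollectI exI[of _ "[x, y]"]) auto
    moreover have "path_weights ?R ?V A x y \<subseteq> carrier ?R"
      by (auto simp: path_weights_def)
    ultimately show ?thesis
      using R.genideal_self by blast
  qed
  ultimately have "A \<in> J.unipotents"
    unfolding J.unipotents_def using carrier by blast
  then have power: "A [^]\<^bsub>mat_monoid ?R ?V\<^esub> m \<in> J.unipotents"
    by (rule J.unipotents_int_pow)
  show ?thesis
    unfolding one_principled_def
    using J.unipotentsD(1)[OF power] J.unipotents_minor[OF power]
      mat_det_principal_submatrix[OF J.unipotents_weighted_digraph[OF power]]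
    by simp
qed

end
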